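(* Let $n\ge 1$ and let $S$ be a sphere in $\mathbb{R}^n$. Then $S$ cannot be partitioned into B-type polytopes and exactly one A-type polytope. That is, there is no finite collection of full-dimensional spherical polytopes in $S$ whose union is $S$, whose interiors (relative to $S$) are pairwise disjoint, and of which exactly one is A-type and all others are B-type.
   Context: Let $S=\{y\in\mathbb{R}^n: |y-c|=r\}$ with centre $c\in\mathbb{R}^n$ and radius $r>0$. A spherical polytope in $S$ is the intersection of $S$ with finitely many (possibly zero) closed halfspaces of $\mathbb{R}^n$ whose bounding hyperplanes all pass through the centre $c$. Polytopes considered here are full-dimensional: they have nonempty interior relative to $S$. Such a polytope is called a B-type polytope if it contains both endpoints of some diameter of $S$ (i.e. contains $c+v$ and $c-v$ for some $v$ with $|v|=r$), and an A-type polytope otherwise. *)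

theory Defs
  imports "HOL-Analysis.Analysis"
begin

definition central_halfspace :: "'a::euclidean_space \<Rightarrow> 'a set \<Rightarrow> bool" where
  "central_halfspace c H \<longleftrightarrow> (\<exists>a b. a \<noteq> 0 \<and> H = {y. a \<bullet> y \<le> b} \<and> a \<bullet> c = b)"

text \<open>The family \<open>\<H>\<close> may be empty, in which case \<open>\<Inter>\<H> = UNIV\<close> and the polytope
  is the whole sphere.\<close>

definition spherical_polytope :: "'a::euclidean_space \<Rightarrow> real \<Rightarrow> 'a set \<Rightarrow> bool" where
  "spherical_polytope c r P \<longleftrightarrow>
     (\<exists>\<H>. finite \<H> \<and> (\<forall>H\<in>\<H>. central_halfspace c H) \<and> P = sphere c r \<inter> \<Inter>\<H>)"

definition sphere_interior :: "'a::euclidean_space \<Rightarrow> real \<Rightarrow> 'a set \<Rightarrow> 'a set" where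
  "sphere_interior c r P = top_of_set (sphere c r) interior_of P"

definition full_dim_spherical_polytope :: "'a::euclidean_space \<Rightarrow> real \<Rightarrow> 'a set \<Rightarrow> bool" where
  "full_dim_spherical_polytope c r P \<longleftrightarrow>
     spherical_polytope c r P \<and> sphere_interior c r P \<noteq> {}"

definition contains_diameter_ends :: "'a::euclidean_space \<Rightarrow> real \<Rightarrow> 'a set \<Rightarrow> bool" where
  "contains_diameter_ends c r P \<longleftrightarrow> (\<exists>v. norm v = r \<and> c + v \<in> P \<and> c - v \<in> P)"

definition B_type :: "'a::euclidean_space \<Rightarrow> real \<Rightarrow> 'a set \<Rightarrow> bool" where
  "B_type c r P \<longleftrightarrow> full_dim_spherical_polytope c r P \<and> contains_diameter_ends c r P"

definition A_type :: "'a::euclidean_space \<Rightarrow> real \<Rightarrow> 'a set \<Rightarrow> bool" where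
  "A_type c r P \<longleftrightarrow> full_dim_spherical_polytope c r P \<and> \<not> contains_diameter_ends c r P"

text \<open>Partitions are sets rather than indexed families of polytopes; since full-dimensional
  polytopes have nonempty interior, a family with pairwise disjoint interiors has no
  repetitions, so nothing is lost.\<close>

definition spherical_partition :: "'a::euclidean_space \<Rightarrow> real \<Rightarrow> 'a set set \<Rightarrow> bool" where
  "spherical_partition c r \<P> \<longleftrightarrow>
     finite \<P> \<and> (\<forall>P\<in>\<P>. full_dim_spherical_polytope c r P) \<and> \<Union>\<P> = sphere c r \<and>
     pairwise (\<lambda>P Q. disjnt (sphere_interior c r P) (sphere_interior c r Q)) \<P>"

end

theory Submission
  imports Defs
begin

text \<open>Pass to the closed cones spanned by the polytopes: they tile the whole space, B-type
  polytopes give cones invariant under a nonzero translation \<open>v\<^sub>Q\<close>, and the A-type polytope gives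
  a pointed cone \<open>K\<close>. Apply the operator \<open>\<Prod>\<^sub>Q (1 - T\<^sub>Q)\<close>, where \<open>T\<^sub>Q\<close> translates by
  \<open>v\<^sub>Q\<close>, to the identity saying that the indicator functions of the cones sum to 1 almost
  everywhere. It annihilates 1 and every B-type indicator, so it annihilates the indicator of \<open>K\<close>.
  Now orient and scale the \<open>v\<^sub>Q\<close> so that a functional that is nonnegative on \<open>K\<close> is large
  on each of them. Near a suitable interior point of \<open>K\<close> only the untranslated term survives,
  and its value is 1: a contradiction.\<close>

section \<open>Cones, polar cones and their duals\<close>

text \<open>The cone over \<open>P\<close>, with its apex moved from \<open>c\<close> to the origin.
  The origin is put in by hand: there \<open>r / norm x\<close> is 0, and the second condition would
  test \<open>c \<in> P\<close>.\<close>

definition direction_cone :: "'a::euclidean_space \<Rightarrow> real \<Rightarrow> 'a set \<Rightarrow> 'a set" where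
  "direction_cone c r P = {x. x = 0 \<or> c + (r / norm x) *\<^sub>R x \<in> P}"

definition polar_cone :: "'a::real_inner set \<Rightarrow> 'a set" where
  "polar_cone N = {x. \<forall>a\<in>N. a \<bullet> x \<le> 0}"

lemma polar_coneD: "x \<in> polar_cone N \<Longrightarrow> a \<in> N \<Longrightarrow> a \<bullet> x \<le> 0"
  by (simp add: polar_cone_def)

lemma polar_cone_eq_Inter: "polar_cone N = (\<Inter>a\<in>N. {x. a \<bullet> x \<le> 0})"
  by (auto simp: polar_cone_def)

lemma closed_polar_cone: "closed (polar_cone N)"
  unfolding polar_cone_eq_Inter by (intro closed_INT ballI closed_halfspace_le)

lemma convex_polar_cone: "convex (polar_cone N)"
  unfolding polar_cone_eq_Inter by (intro convex_INT convex_halfspace_le)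

lemma polar_cone_scaleR: "x \<in> polar_cone N \<Longrightarrow> t \<ge> 0 \<Longrightarrow> t *\<^sub>R x \<in> polar_cone N"
  by (simp add: polar_cone_def mult_nonneg_nonpos)

text \<open>Membership of both \<open>v\<close> and \<open>- v\<close> makes every normal
  \<open>a\<close> orthogonal to \<open>v\<close>, so moving by \<open>v\<close> changes no
  \<open>a \<bullet> x\<close>.\<close>

lemma polar_cone_add_line:
  assumes "v \<in> polar_cone N" "- v \<in> polar_cone N"
  shows "x + v \<in> polar_cone N \<longleftrightarrow> x \<in> polar_cone N"
proof -
  have "a \<bullet> v = 0" if "a \<in> N" for a
    using assms that by (force simp: polar_cone_def)
  then show ?thesis by (simp add: polar_cone_def inner_add_right)
qed

text \<open>The negated sum of the normals is positive at each nonzero \<open>x\<close> of the cone: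
  if it vanished, so would every \<open>a \<bullet> x\<close>, and \<open>- x\<close> would lie in
  the cone too. On the compact set of unit vectors of the cone it has a positive lower bound, which
  leaves room for small changes of the functional.\<close>

lemma interior_dual_of_pointed_cone:
  fixes N :: "'a::euclidean_space set"
  assumes "finite N"
    and pointed: "\<And>x. x \<in> polar_cone N \<Longrightarrow> - x \<in> polar_cone N \<Longrightarrow> x = 0"
  shows "interior {\<xi>. \<forall>x\<in>polar_cone N. 0 \<le> \<xi> \<bullet> x} \<noteq> {}"
proof -
  define \<xi> where "\<xi> = - (\<Sum>a\<in>N. a)"
  define C where "C = polar_cone N \<inter> sphere 0 1"
  have pos: "0 < \<xi> \<bullet> x" if "x \<in> C" for x
  proof -
    have x: "x \<in> polar_cone N" "x \<noteq> 0" using that by (auto simp: C_def)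
    have eq: "\<xi> \<bullet> x = (\<Sum>a\<in>N. - (a \<bullet> x))"
      by (simp add: \<xi>_def inner_sum_left sum_negf)
    have nn: "0 \<le> - (a \<bullet> x)" if "a \<in> N" for a using polar_coneD[OF x(1) that] by simp
    have "\<xi> \<bullet> x \<noteq> 0"
    proof
      assume "\<xi> \<bullet> x = 0"
      then have "\<forall>a\<in>N. - (a \<bullet> x) = 0"
        unfolding eq using sum_nonneg_eq_0_iff[OF \<open>finite N\<close>, of "\<lambda>a. - (a \<bullet> x)"] nn by blast
      then have "- x \<in> polar_cone N" by (simp add: polar_cone_def)
      then show False using pointed x by blast
    qed
    moreover have "0 \<le> \<xi> \<bullet> x" unfolding eq by (intro sum_nonneg nn)
    ultimately show ?thesis by simp
  qed
  have "compact C"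
    unfolding C_def by (intro closed_Int_compact closed_polar_cone compact_sphere)
  have "\<exists>\<delta>>0. \<forall>x\<in>C. \<delta> \<le> \<xi> \<bullet> x"
  \<comment> \<open>If the cone is just \<open>{0}\<close>, no minimum is available, but any
    positive bound will do.\<close>
  proof (cases "C = {}")
    case True
    then show ?thesis using zero_less_one by blast
  next
    case False
    have "continuous_on C (\<lambda>x. \<xi> \<bullet> x)" by (intro continuous_intros)
    from continuous_attains_inf[OF \<open>compact C\<close> False this] show ?thesis
      using pos by blast
  qed
  then obtain \<delta> where \<delta>: "\<delta> > 0" "\<And>x. x \<in> C \<Longrightarrow> \<delta> \<le> \<xi> \<bullet> x" by blast
  have "ball \<xi> \<delta> \<subseteq> {\<xi>. \<forall>x\<in>polar_cone N. 0 \<le> \<xi> \<bullet> x}"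
  proof (intro subsetI CollectI ballI)
    fix \<eta> x assume \<eta>: "\<eta> \<in> ball \<xi> \<delta>" and x: "x \<in> polar_cone N"
    show "0 \<le> \<eta> \<bullet> x"
    proof (cases "x = 0")
      case False
      define u where "u = (1 / norm x) *\<^sub>R x"
      have "u \<in> C" using x False by (auto simp: C_def u_def intro: polar_cone_scaleR)
      then have "norm u = 1" by (simp add: C_def)
      have "(\<xi> - \<eta>) \<bullet> u \<le> norm (\<xi> - \<eta>)"
        using norm_cauchy_schwarz[of "\<xi> - \<eta>" u] \<open>norm u = 1\<close> by simp
      also have "\<dots> < \<delta>" using \<eta> by (simp add: dist_norm)
      finally have "0 \<le> \<eta> \<bullet> u" using \<delta>(2)[OF \<open>u \<in> C\<close>] by (simp add: inner_diff_left)
      moreover have "x = norm x *\<^sub>R u" using False by (simp add: u_def)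
      ultimately show ?thesis by (metis inner_scaleR_right norm_ge_zero mult_nonneg_nonneg)
    qed simp
  qed
  then have "\<xi> \<in> interior {\<xi>. \<forall>x\<in>polar_cone N. 0 \<le> \<xi> \<bullet> x}"
    using \<open>\<delta> > 0\<close> by (meson centre_in_ball interior_maximal open_ball subsetD)
  then show ?thesis by blast
qed

section \<open>Alternating sums and tilings by convex sets\<close>

text \<open>Each set without \<open>q\<close> is paired with the same set enlarged by
  \<open>q\<close>: equal values, opposite signs. In this form a single factor of the expanded
  operator product annihilates a function invariant under its translation.\<close>

lemma alternating_sum_Pow_eq_0:
  fixes g :: "'i set \<Rightarrow> int"
  assumes "finite I" "q \<in> I" and g: "\<And>S. S \<subseteq> I - {q} \<Longrightarrow> g (insert q S) = g S"
  shows "(\<Sum>S\<in>Pow I. (- 1) ^ card S * g S) = 0"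
proof -
  let ?J = "I - {q}"
  have fin: "finite ?J" using assms by simp
  have "Pow I = Pow ?J \<union> insert q ` Pow ?J"
    using Pow_insert[of q ?J] insert_Diff[OF \<open>q \<in> I\<close>] by simp
  moreover have "Pow ?J \<inter> insert q ` Pow ?J = {}" by auto
  moreover have "inj_on (insert q) (Pow ?J)" by (auto simp: inj_on_def)
  ultimately have "(\<Sum>S\<in>Pow I. (- 1) ^ card S * g S)
    = (\<Sum>S\<in>Pow ?J. (- 1) ^ card S * g S)
      + (\<Sum>S\<in>Pow ?J. (- 1) ^ card (insert q S) * g (insert q S))"
    using fin by (simp add: sum.union_disjoint sum.reindex)
  also have "(\<Sum>S\<in>Pow ?J. (- 1) ^ card (insert q S) * g (insert q S))
    = (\<Sum>S\<in>Pow ?J. - ((- 1) ^ card S * g S))"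
  proof (rule sum.cong)
    fix S assume S: "S \<in> Pow ?J"
    then have "finite S" "q \<notin> S" using fin finite_subset by auto
    then show "(- 1) ^ card (insert q S) * g (insert q S) = - ((- 1) ^ card S * g S)"
      using g S by simp
  qed simp
  finally show ?thesis by (simp add: sum_negf)
qed

lemma open_not_subset_negligible:
  fixes U :: "'a::euclidean_space set"
  assumes "open U" "U \<noteq> {}" "negligible N"
  obtains x where "x \<in> U" "x \<notin> N"
  using assms negligible_subset open_not_negligible by blast

text \<open>Off the frontiers, a point of a tile is interior to it, and interiors are disjoint. This
  is the pointwise form of the almost-everywhere identity for the indicators.\<close>

lemma tiling_generic_point:
  fixes K :: "'i \<Rightarrow> 'a::euclidean_space set"
  assumes "finite I" and cover: "(\<Union>i\<in>I. K i) = UNIV"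
    and disj: "\<And>i j. i \<in> I \<Longrightarrow> j \<in> I \<Longrightarrow> i \<noteq> j \<Longrightarrow> interior (K i) \<inter> interior (K j) = {}"
    and y: "y \<notin> (\<Union>i\<in>I. frontier (K i))"
  shows "(\<Sum>i\<in>I. of_bool (y \<in> K i)) = (1 :: int)"
proof -
  have int: "y \<in> interior (K i)" if "i \<in> I" "y \<in> K i" for i
    using y that closure_subset[of "K i"] by (auto simp: frontier_def)
  obtain i where i: "i \<in> I" "y \<in> K i" using cover by blast
  have "(\<Sum>j\<in>I. of_bool (y \<in> K j)) = (\<Sum>j\<in>I. if j = i then 1 else 0 :: int)"
    using i int disj by (intro sum.cong) (auto, blast)
  then show ?thesis using i \<open>finite I\<close> by simp
qed

text \<open>Pointedness of \<open>K p\<close> enters as a dual cone with nonempty interior: it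
  leaves room for a functional that vanishes on none of the chosen invariant directions.\<close>

lemma no_tiling_with_one_pointed_cone:
  fixes K :: "'i \<Rightarrow> 'a::euclidean_space set"
  assumes "finite I" and "p \<in> I" and ne: "I - {p} \<noteq> {}"
    and conv: "\<And>i. i \<in> I \<Longrightarrow> convex (K i)"
    and cover: "(\<Union>i\<in>I. K i) = UNIV"
    and disj: "\<And>i j. i \<in> I \<Longrightarrow> j \<in> I \<Longrightarrow> i \<noteq> j \<Longrightarrow> interior (K i) \<inter> interior (K j) = {}"
    and int: "interior (K p) \<noteq> {}"
    and dual: "interior {\<xi>. \<forall>x\<in>K p. 0 \<le> \<xi> \<bullet> x} \<noteq> {}"
    and line: "\<And>i. i \<in> I - {p} \<Longrightarrow> \<exists>v. v \<noteq> 0 \<and> (\<forall>x t. x + t *\<^sub>R v \<in> K i \<longleftrightarrow> x \<in> K i)"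
  shows False
proof -
  define J where "J = I - {p}"
  have "finite J" "J \<noteq> {}" using \<open>finite I\<close> ne by (auto simp: J_def)
  obtain w where w: "\<And>i. i \<in> J \<Longrightarrow> w i \<noteq> 0"
      "\<And>i x t. i \<in> J \<Longrightarrow> x + t *\<^sub>R w i \<in> K i \<longleftrightarrow> x \<in> K i"
    using line unfolding J_def by metis
  have "negligible (\<Union>i\<in>J. {\<xi>. w i \<bullet> \<xi> = 0})"
    using \<open>finite J\<close> w(1) by (intro negligible_Union) (auto intro: negligible_hyperplane)
  then obtain \<xi> where \<xi>: "\<xi> \<in> interior {\<xi>. \<forall>x\<in>K p. 0 \<le> \<xi> \<bullet> x}"
      "\<xi> \<notin> (\<Union>i\<in>J. {\<xi>. w i \<bullet> \<xi> = 0})"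
    using open_not_subset_negligible[OF open_interior dual] by blast
  have nonneg: "\<And>x. x \<in> K p \<Longrightarrow> 0 \<le> \<xi> \<bullet> x" using \<xi>(1) interior_subset by blast
  have wpos: "\<xi> \<bullet> w i \<noteq> 0" if "i \<in> J" for i
    using \<xi>(2) that by (auto simp: inner_commute)
  obtain x0 where x0: "x0 \<in> interior (K p)" using int by blast
  \<comment> \<open>The summand 1 puts \<open>x0\<close> strictly below the level \<open>m\<close>
    and makes \<open>m\<close> positive.\<close>
  define m where "m = \<xi> \<bullet> x0 + 1"
  have "m > 0" using nonneg x0 interior_subset unfolding m_def
    by (metis add_nonneg_pos subsetD zero_less_one)
  \<comment> \<open>Dividing by \<open>\<xi> \<bullet> w i\<close> settles orientation and length
    together: every \<open>v i\<close> has level exactly \<open>m\<close>.\<close>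
  define v where "v i = (m / (\<xi> \<bullet> w i)) *\<^sub>R w i" for i
  have \<xi>v: "\<xi> \<bullet> v i = m" if "i \<in> J" for i using wpos[OF that] by (simp add: v_def)
  have trans: "x - v i \<in> K i \<longleftrightarrow> x \<in> K i" if "i \<in> J" for i x
    using w(2)[OF that, of x "- (m / (\<xi> \<bullet> w i))"] by (simp add: v_def)
  \<comment> \<open>The points with some translate, by a partial sum of the \<open>v i\<close>, on a
    frontier. Convexity makes the frontiers negligible, so \<open>x\<close> can avoid them all at
    once.\<close>
  define bad where
    "bad = (\<Union>S\<in>Pow J. (+) (\<Sum>i\<in>S. v i) ` (\<Union>i\<in>I. frontier (K i)))"
  have "negligible (\<Union>i\<in>I. frontier (K i))"
    using \<open>finite I\<close> conv by (intro negligible_Union) (auto intro: negligible_convex_frontier)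
  then have "negligible bad"
    unfolding bad_def using \<open>finite J\<close>
    by (intro negligible_Union) (auto intro: negligible_translation)
  moreover have "open (interior (K p) \<inter> {x. \<xi> \<bullet> x < m})"
    by (intro open_Int open_interior open_halfspace_lt)
  moreover have "x0 \<in> interior (K p) \<inter> {x. \<xi> \<bullet> x < m}" using x0 by (simp add: m_def)
  ultimately obtain x where x: "x \<in> interior (K p)" "\<xi> \<bullet> x < m" "x \<notin> bad"
    using open_not_subset_negligible by blast
  define y where "y S = x - (\<Sum>i\<in>S. v i)" for S
  have y_generic: "(\<Sum>i\<in>I. of_bool (y S \<in> K i)) = (1 :: int)" if "S \<in> Pow J" for S
  proof (rule tiling_generic_point[OF \<open>finite I\<close> cover disj])
    show "y S \<notin> (\<Union>i\<in>I. frontier (K i))"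
    proof
      assume "y S \<in> (\<Union>i\<in>I. frontier (K i))"
      then have "(\<Sum>i\<in>S. v i) + y S \<in> bad" using that unfolding bad_def by blast
      then show False using x(3) by (simp add: y_def)
    qed
  qed
  \<comment> \<open>The value at \<open>x\<close> of the operator product applied to the indicator
    of \<open>K i\<close>, expanded over subsets of \<open>J\<close>.\<close>
  let ?sum = "\<lambda>i. \<Sum>S\<in>Pow J. (- 1) ^ card S * of_bool (y S \<in> K i) :: int"
  have B: "?sum i = 0" if "i \<in> J" for i
  proof (rule alternating_sum_Pow_eq_0[OF \<open>finite J\<close> that])
    fix S assume "S \<subseteq> J - {i}"
    then have "finite S" "i \<notin> S" using \<open>finite J\<close> finite_subset by auto
    then have "y (insert i S) = y S - v i" by (simp add: y_def)
    then show "of_bool (y (insert i S) \<in> K i) = (of_bool (y S \<in> K i) :: int)"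
      using trans[OF that] by simp
  qed
  \<comment> \<open>Each subtracted \<open>v i\<close> lowers the level by \<open>m\<close>, and
    \<open>x\<close> starts below \<open>m\<close>; so \<open>y S\<close> has negative level,
    impossible in \<open>K p\<close>.\<close>
  have "y S \<notin> K p" if S: "S \<in> Pow J" "S \<noteq> {}" for S
  proof -
    have "finite S" using S \<open>finite J\<close> finite_subset by auto
    then have "card S \<ge> 1" using S by (simp add: Suc_leI card_gt_0_iff)
    have "\<xi> \<bullet> (\<Sum>i\<in>S. v i) = (\<Sum>i\<in>S. m)"
      unfolding inner_sum_right using S \<xi>v by (intro sum.cong) auto
    also have "\<dots> = card S * m" by simp
    also have "\<dots> \<ge> 1 * m" using \<open>card S \<ge> 1\<close> \<open>m > 0\<close> by (intro mult_right_mono) auto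
    finally have "\<xi> \<bullet> y S < 0" using x(2) by (simp add: y_def inner_diff_right)
    then show ?thesis using nonneg by force
  qed
  then have "?sum p = (\<Sum>S\<in>Pow J. if S = {} then 1 else 0)"
    using x(1) interior_subset by (intro sum.cong) (auto simp: y_def)
  also have "\<dots> = 1" using \<open>finite J\<close> by simp
  finally have A: "?sum p = 1" .
  \<comment> \<open>Double counting: summing over tiles first gives 1 at each \<open>y S\<close>,
    hence an alternating sum of ones, which is 0 because \<open>J\<close> is nonempty. Tile by tile
    the total is 1 from \<open>p\<close> and 0 from the others.\<close>
  have "(\<Sum>i\<in>I. ?sum i) = (\<Sum>S\<in>Pow J. (- 1) ^ card S * (\<Sum>i\<in>I. of_bool (y S \<in> K i)))"
    by (subst sum.swap) (simp add: sum_distrib_left)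
  also have "\<dots> = (\<Sum>S\<in>Pow J. (- 1) ^ card S * 1)"
    using y_generic by (intro sum.cong) auto
  also obtain q where "q \<in> J" using \<open>J \<noteq> {}\<close> by blast
  then have "(\<Sum>S\<in>Pow J. (- 1) ^ card S * 1) = (0 :: int)"
    by (intro alternating_sum_Pow_eq_0[OF \<open>finite J\<close>]) auto
  finally have "(\<Sum>i\<in>I. ?sum i) = 0" .
  moreover have "(\<Sum>i\<in>I. ?sum i) = ?sum p + (\<Sum>i\<in>J. ?sum i)"
    unfolding J_def using \<open>finite I\<close> \<open>p \<in> I\<close> by (rule sum.remove)
  ultimately show False using A B by simp
qed

section \<open>From spherical polytopes to cones\<close>

text \<open>Since the hyperplanes pass through \<open>c\<close>, the inequality at
  \<open>c + s *\<^sub>R x\<close> with \<open>s > 0\<close> reduces to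
  \<open>a \<bullet> x \<le> 0\<close>; the normals form \<open>N\<close>.\<close>

lemma direction_cone_polar:
  fixes c :: "'a::euclidean_space"
  assumes "r > 0" "spherical_polytope c r P"
  obtains N where "finite N" "direction_cone c r P = polar_cone N"
proof -
  obtain \<H> where H: "finite \<H>" "\<And>H. H \<in> \<H> \<Longrightarrow> central_halfspace c H"
      "P = sphere c r \<inter> \<Inter>\<H>"
    using assms unfolding spherical_polytope_def by blast
  have "\<exists>a. H = {y. a \<bullet> y \<le> a \<bullet> c}" if "H \<in> \<H>" for H
    using H(2)[OF that] unfolding central_halfspace_def by blast
  then obtain f where f: "\<And>H. H \<in> \<H> \<Longrightarrow> H = {y. f H \<bullet> y \<le> f H \<bullet> c}" by metis
  have "x \<in> direction_cone c r P \<longleftrightarrow> x \<in> polar_cone (f ` \<H>)" for x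
  proof (cases "x = 0")
    case False
    have "c + (r / norm x) *\<^sub>R x \<in> H \<longleftrightarrow> f H \<bullet> x \<le> 0" if "H \<in> \<H>" for H
    proof -
      have "c + (r / norm x) *\<^sub>R x \<in> H \<longleftrightarrow> (r / norm x) * (f H \<bullet> x) \<le> 0"
        by (subst f[OF that]) (simp add: inner_add_right)
      also have "\<dots> \<longleftrightarrow> f H \<bullet> x \<le> 0" using False \<open>r > 0\<close>
        by (simp add: mult_le_0_iff divide_le_0_iff)
      finally show ?thesis .
    qed
    moreover have "c + (r / norm x) *\<^sub>R x \<in> sphere c r"
      using False \<open>r > 0\<close> by (simp add: dist_norm)
    ultimately show ?thesis using False by (simp add: direction_cone_def polar_cone_def H(3))
  qed (simp add: direction_cone_def polar_cone_def)
  then show ?thesis using that[of "f ` \<H>"] H(1) by blast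
qed

lemma direction_cone_sphere_iff:
  assumes "t > 0" "r > 0" "norm v = r"
  shows "t *\<^sub>R v \<in> direction_cone c r P \<longleftrightarrow> c + v \<in> P"
  using assms by (auto simp: direction_cone_def)

lemma interior_direction_cone_imp:
  assumes "r > 0" "x \<in> interior (direction_cone c r P)" "x \<noteq> 0" "P \<subseteq> sphere c r"
  shows "c + (r / norm x) *\<^sub>R x \<in> sphere_interior c r P"
proof -
  let ?p = "c + (r / norm x) *\<^sub>R x" and ?t = "norm x / r"
  \<comment> \<open>With this \<open>?t\<close>, the continuous map
    \<open>y \<mapsto> ?t *\<^sub>R (y - c)\<close> sends \<open>?p\<close> to \<open>x\<close>, so
    \<open>?T\<close> is a relative neighbourhood of \<open>?p\<close>.\<close>
  let ?T = "sphere c r \<inter> (\<lambda>y. ?t *\<^sub>R (y - c)) -` interior (direction_cone c r P)"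
  have "open ((\<lambda>y. ?t *\<^sub>R (y - c)) -` interior (direction_cone c r P))"
    by (intro open_vimage open_interior continuous_intros)
  then have "openin (top_of_set (sphere c r)) ?T" by (rule openin_open_Int)
  moreover have "?p \<in> ?T" using assms by (simp add: dist_norm)
  moreover have "?T \<subseteq> P"
  proof
    fix y assume y: "y \<in> ?T"
    then have "?t *\<^sub>R (y - c) \<in> direction_cone c r P" using interior_subset by blast
    moreover have "norm (y - c) = r" using y by (simp add: dist_norm norm_minus_commute)
    moreover have "?t > 0" using assms by simp
    ultimately show "y \<in> P" using direction_cone_sphere_iff[of ?t r "y - c" c P] assms(1) by simp
  qed
  ultimately show ?thesis unfolding sphere_interior_def interior_of_def by blast
qed

lemma interior_direction_cone_nonempty:
  fixes c :: "'a::euclidean_space"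
  assumes "r > 0" "sphere_interior c r P \<noteq> {}"
  shows "interior (direction_cone c r P) \<noteq> {}"
proof -
  obtain p V where V: "open V" "p \<in> V" "p \<in> sphere c r" "sphere c r \<inter> V \<subseteq> P"
    using assms(2) unfolding sphere_interior_def interior_of_def openin_open by auto
  \<comment> \<open>Radial projection to the sphere is continuous away from 0, so it pulls
    \<open>V\<close> back to an open set of directions.\<close>
  let ?f = "\<lambda>x. c + (r / norm x) *\<^sub>R x" and ?W = "- {0::'a}"
  have "continuous_on ?W ?f" by (intro continuous_intros) auto
  then have "open (?W \<inter> ?f -` V)" using V(1) by (intro continuous_open_preimage) auto
  moreover have "?W \<inter> ?f -` V \<subseteq> direction_cone c r P"
  proof
    fix x assume x: "x \<in> ?W \<inter> ?f -` V"
    then have "?f x \<in> sphere c r" using assms(1) by (simp add: dist_norm)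
    then show "x \<in> direction_cone c r P" using x V(4) unfolding direction_cone_def by blast
  qed
  moreover have "p - c \<in> ?W \<inter> ?f -` V"
  proof -
    have "norm (p - c) = r" using V(3) by (simp add: dist_norm norm_minus_commute)
    then show ?thesis using V(2) \<open>r > 0\<close> by auto
  qed
  ultimately show ?thesis using interior_maximal by blast
qed

text \<open>A common nonzero interior point would project to a common interior point on the sphere.
  Only the origin remains, and a singleton is not open.\<close>

lemma interior_direction_cone_disjoint:
  fixes c :: "'a::euclidean_space"
  assumes "r > 0" "P \<subseteq> sphere c r" "Q \<subseteq> sphere c r"
    and "disjnt (sphere_interior c r P) (sphere_interior c r Q)"
  shows "interior (direction_cone c r P) \<inter> interior (direction_cone c r Q) = {}" (is "?I = {}")
proof -
  have "?I \<subseteq> {0}"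
  proof
    fix x assume "x \<in> ?I"
    then show "x \<in> {0}"
      using assms interior_direction_cone_imp[of r x c] unfolding disjnt_def by blast
  qed
  moreover have "open ?I" by (intro open_Int open_interior)
  ultimately show ?thesis using not_open_singleton[of "0::'a"] by (metis subset_singletonD)
qed

theorem theorem2p4:
  fixes c :: "real ^ 'n" and r :: real
  assumes "r > 0"
  shows "\<not> (\<exists>\<P>. spherical_partition c r \<P> \<and>
               (\<exists>P\<in>\<P>. A_type c r P \<and> (\<forall>Q\<in>\<P> - {P}. B_type c r Q)))"
proof
  assume "\<exists>\<P>. spherical_partition c r \<P> \<and>
               (\<exists>P\<in>\<P>. A_type c r P \<and> (\<forall>Q\<in>\<P> - {P}. B_type c r Q))"
  then obtain \<P> P where part: "spherical_partition c r \<P>" and P: "P \<in> \<P>" "A_type c r P"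
    and B: "\<And>Q. Q \<in> \<P> - {P} \<Longrightarrow> B_type c r Q" by blast
  let ?K = "direction_cone c r"
  have fin: "finite \<P>" and full: "\<And>Q. Q \<in> \<P> \<Longrightarrow> full_dim_spherical_polytope c r Q"
    and un: "\<Union>\<P> = sphere c r"
    and disj: "\<And>Q R. Q \<in> \<P> \<Longrightarrow> R \<in> \<P> \<Longrightarrow> Q \<noteq> R \<Longrightarrow>
      disjnt (sphere_interior c r Q) (sphere_interior c r R)"
    using part unfolding spherical_partition_def pairwise_def by auto
  have sph: "Q \<subseteq> sphere c r" if "Q \<in> \<P>" for Q using un that by blast
  have polar: "\<exists>N. finite N \<and> ?K Q = polar_cone N" if "Q \<in> \<P>" for Q
    using full[OF that] direction_cone_polar[OF \<open>r > 0\<close>]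
    unfolding full_dim_spherical_polytope_def by metis
  have noends: "\<not> contains_diameter_ends c r P" using P(2) by (simp add: A_type_def)
  show False
  proof (rule no_tiling_with_one_pointed_cone[where K = ?K, OF fin P(1)])
    \<comment> \<open>A lone polytope would be the whole sphere, which contains diameters.\<close>
    show "\<P> - {P} \<noteq> {}"
    proof
      assume "\<P> - {P} = {}"
      then have "P = sphere c r" using P(1) un by blast
      moreover obtain v :: "real ^ 'n" where "norm v = r"
        using vector_choose_size[of r] \<open>r > 0\<close> by auto
      ultimately have "contains_diameter_ends c r P"
        by (auto simp: contains_diameter_ends_def dist_norm)
      then show False using noends by blast
    qed
    show "convex (?K Q)" if "Q \<in> \<P>" for Q using polar[OF that] convex_polar_cone by metis
    show "(\<Union>Q\<in>\<P>. ?K Q) = UNIV"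
    proof (intro set_eqI iffI UNIV_I)
      fix x :: "real ^ 'n"
      show "x \<in> (\<Union>Q\<in>\<P>. ?K Q)"
      proof (cases "x = 0")
        case True
        then show ?thesis using P(1) by (auto simp: direction_cone_def)
      next
        case False
        then have "c + (r / norm x) *\<^sub>R x \<in> \<Union>\<P>" unfolding un using \<open>r > 0\<close> by (simp add: dist_norm)
        then show ?thesis by (auto simp: direction_cone_def)
      qed
    qed
    show "interior (?K Q) \<inter> interior (?K R) = {}" if "Q \<in> \<P>" "R \<in> \<P>" "Q \<noteq> R" for Q R
      using that by (intro interior_direction_cone_disjoint \<open>r > 0\<close> sph disj)
    show "interior (?K P) \<noteq> {}"
      using full[OF P(1)] \<open>r > 0\<close> unfolding full_dim_spherical_polytope_def
      by (intro interior_direction_cone_nonempty) auto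
    obtain N where N: "finite N" "?K P = polar_cone N" using polar[OF P(1)] by blast
    have "x = 0" if x: "x \<in> ?K P" "- x \<in> ?K P" for x
    \<comment> \<open>Scaled to length \<open>r\<close>, opposite vectors of the cone give the ends
      of a diameter in \<open>P\<close>.\<close>
    proof (rule ccontr)
      assume "x \<noteq> 0"
      then have "contains_diameter_ends c r P"
        using x \<open>r > 0\<close> unfolding contains_diameter_ends_def direction_cone_def
        by (intro exI[of _ "(r / norm x) *\<^sub>R x"]) auto
      then show False using noends by blast
    qed
    then show "interior {\<xi>. \<forall>x\<in>?K P. 0 \<le> \<xi> \<bullet> x} \<noteq> {}"
      unfolding N(2) by (intro interior_dual_of_pointed_cone[OF N(1)])
    show "\<exists>v. v \<noteq> 0 \<and> (\<forall>x t. x + t *\<^sub>R v \<in> ?K Q \<longleftrightarrow> x \<in> ?K Q)" if Q: "Q \<in> \<P> - {P}" for Q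
    proof -
      obtain N where N: "?K Q = polar_cone N" using polar Q by blast
      obtain v where v: "norm v = r" "c + v \<in> Q" "c - v \<in> Q"
        using B[OF Q] unfolding B_type_def contains_diameter_ends_def by blast
      then have vK: "v \<in> polar_cone N" "- v \<in> polar_cone N"
        using direction_cone_sphere_iff[of 1 r v c Q] direction_cone_sphere_iff[of 1 r "- v" c Q]
          \<open>r > 0\<close> N by auto
      \<comment> \<open>Cones allow only nonnegative factors, so negative \<open>t\<close> is
        handled as \<open>- t\<close> times \<open>- v\<close>.\<close>
      have tv: "t *\<^sub>R v \<in> polar_cone N" for t
        using polar_cone_scaleR[OF vK(1), of t] polar_cone_scaleR[OF vK(2), of "- t"] by fastforce
      have "x + t *\<^sub>R v \<in> ?K Q \<longleftrightarrow> x \<in> ?K Q" for x t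
        unfolding N using tv[of t] tv[of "- t"] by (intro polar_cone_add_line) auto
      then show ?thesis using v(1) \<open>r > 0\<close> by auto
    qed
  qed
qed

end
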